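(* Let $(X,d)$ be a nonempty ultrametric space. Suppose that either $X$ is finite, or $X$ has a limit point. Then $(X,d)$ is a $\mathbf{US}$-space if and only if $(X,d)$ contains no four-point subspace which is weakly similar to $(X_4,d_4)$ or to $(Y_4,\rho_4)$.
   Context: Let $\mathbb{R}^+=[0,\infty)$. A semimetric on a nonempty set $X$ is a symmetric function $d\colon X\times X\to\mathbb{R}^+$ with $d(x,y)=0$ iff $x=y$; it is an ultrametric if $d(x,y)\le\max\{d(x,z),d(z,y)\}$ for all $x,y,z\in X$. A point $a\in X$ is a limit point of $X$ if there is a sequence of (pairwise) distinct points of $X$ converging to $a$. A tree $T$ (finite or infinite, connected simple graph without cycles, with nonempty vertex set) is a star graph with center $c\in V(T)$ if $c$ is adjacent to every other vertex and no two vertices different from $c$ are adjacent. A labeled tree $T(l)$ is a tree $T$ with a labeling $l\colon V(T)\to\mathbb{R}^+$. For a labeled tree define $d_l(u,u)=0$ and, for $u\neq v$, $d_l(u,v)=\max_{w\in V(P)} l(w)$, where $P$ is the path joining $u$ and $v$ in $T$ (endpoints included). An ultrametric space $(X,d)$ is generated by $T(l)$ if $X=V(T)$ and $d=d_l$. An ultrametric space is a $\mathbf{US}$-space (belongs to the class $\mathbf{US}$) if it is generated by some labeled star graph. For a semimetric space put $D(X)=\{d(x,y):x,y\in X\}$. Semimetric spaces $(X,d)$ and $(Y,\rho)$ are weakly similar if there are a bijection $\Phi\colon X\to Y$ and a strictly increasing bijection $f\colon D(Y)\to D(X)$ such that $d(x,y)=f(\rho(\Phi(x),\Phi(y)))$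 for all $x,y\in X$. $(X_4,d_4)$ is the four-point ultrametric space $\{a,b,c,e\}$ with $d_4(a,c)=1$, $d_4(b,e)=2$, and all other distances between distinct points equal to $3$. $(Y_4,\rho_4)$ is the four-point ultrametric space $\{a,b,c,e\}$ with $\rho_4(a,c)=2$, $\rho_4(b,e)=2$, and all other distances between distinct points equal to $3$. *)

theory Defs
  imports Complex_Main "Graph_Theory.Graph_Theory"
begin

definition semimetric_space :: "'a set \<Rightarrow> ('a \<Rightarrow> 'a \<Rightarrow> real) \<Rightarrow> bool" where
  "semimetric_space X d \<longleftrightarrow> X \<noteq> {} \<and>
     (\<forall>x\<in>X. \<forall>y\<in>X. 0 \<le> d x y \<and> d x y = d y x \<and> (d x y = 0 \<longleftrightarrow> x = y))"

definition ultrametric_space :: "'a set \<Rightarrow> ('a \<Rightarrow> 'a \<Rightarrow> real) \<Rightarrow> bool" where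
  "ultrametric_space X d \<longleftrightarrow> semimetric_space X d \<and>
     (\<forall>x\<in>X. \<forall>y\<in>X. \<forall>z\<in>X. d x y \<le> max (d x z) (d z y))"

definition limit_point_of :: "'a set \<Rightarrow> ('a \<Rightarrow> 'a \<Rightarrow> real) \<Rightarrow> 'a \<Rightarrow> bool" where
  "limit_point_of X d a \<longleftrightarrow> a \<in> X \<and>
     (\<exists>s :: nat \<Rightarrow> 'a. inj s \<and> range s \<subseteq> X \<and> (\<lambda>n. d (s n) a) \<longlonglongrightarrow> 0)"

text \<open>
  A (finite or infinite) simple graph is represented by the symmetric loop-free digraph having
  both arcs \<open>(u, v)\<close> and \<open>(v, u)\<close> for each edge \<open>{u, v}\<close>. The closed walk \<open>u, v, u\<close> along a single
  edge is a cycle of that digraph but not of the graph, so cycles must have length at least 3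
  (for the same reason the predicate \<open>tree\<close> of \<open>Graph_Theory\<close>, meant for digraphs, does not apply).
  Connectedness there includes that the vertex set is nonempty.
\<close>

definition graph_tree :: "'a pair_pre_digraph \<Rightarrow> bool" where
  "graph_tree T \<longleftrightarrow> pair_bidirected_digraph T \<and> Digraph_Component.connected (with_proj T) \<and>
     (\<nexists>p. pre_digraph.cycle (with_proj T) p \<and> 3 \<le> length p)"

definition star_graph :: "'a pair_pre_digraph \<Rightarrow> 'a \<Rightarrow> bool" where
  "star_graph T c \<longleftrightarrow> graph_tree T \<and> c \<in> pverts T \<and>
     (\<forall>v \<in> pverts T - {c}. (c, v) \<in> parcs T) \<and>
     (\<forall>u \<in> pverts T - {c}. \<forall>v \<in> pverts T - {c}. (u, v) \<notin> parcs T)"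

definition labeled_tree :: "'a pair_pre_digraph \<Rightarrow> ('a \<Rightarrow> real) \<Rightarrow> bool" where
  "labeled_tree T l \<longleftrightarrow> graph_tree T \<and> (\<forall>v \<in> pverts T. 0 \<le> l v)"

definition tree_path :: "'a pair_pre_digraph \<Rightarrow> 'a \<Rightarrow> 'a \<Rightarrow> ('a \<times> 'a) list" where
  "tree_path T u v = (THE p. pre_digraph.apath (with_proj T) u p v)"

definition label_dist :: "'a pair_pre_digraph \<Rightarrow> ('a \<Rightarrow> real) \<Rightarrow> 'a \<Rightarrow> 'a \<Rightarrow> real" where
  "label_dist T l u v =
     (if u = v then 0
      else Max (l ` set (pre_digraph.awalk_verts (with_proj T) u (tree_path T u v))))"

definition generated_by ::
  "'a set \<Rightarrow> ('a \<Rightarrow> 'a \<Rightarrow> real) \<Rightarrow> 'a pair_pre_digraph \<Rightarrow> ('a \<Rightarrow> real) \<Rightarrow> bool" where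
  "generated_by X d T l \<longleftrightarrow> labeled_tree T l \<and> X = pverts T \<and>
     (\<forall>x\<in>X. \<forall>y\<in>X. d x y = label_dist T l x y)"

definition US_space :: "'a set \<Rightarrow> ('a \<Rightarrow> 'a \<Rightarrow> real) \<Rightarrow> bool" where
  "US_space X d \<longleftrightarrow> ultrametric_space X d \<and>
     (\<exists>T l c. star_graph T c \<and> generated_by X d T l)"

definition dist_set :: "'a set \<Rightarrow> ('a \<Rightarrow> 'a \<Rightarrow> real) \<Rightarrow> real set" where
  "dist_set X d = {d x y | x y. x \<in> X \<and> y \<in> X}"

definition weakly_similar ::
  "'a set \<Rightarrow> ('a \<Rightarrow> 'a \<Rightarrow> real) \<Rightarrow> 'b set \<Rightarrow> ('b \<Rightarrow> 'b \<Rightarrow> real) \<Rightarrow> bool" where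
  "weakly_similar X d Y \<rho> \<longleftrightarrow>
     (\<exists>\<Phi> f. bij_betw \<Phi> X Y \<and>
        bij_betw f (dist_set Y \<rho>) (dist_set X d) \<and> strict_mono_on (dist_set Y \<rho>) f \<and>
        (\<forall>x\<in>X. \<forall>y\<in>X. d x y = f (\<rho> (\<Phi> x) (\<Phi> y))))"

datatype four_points = pt_a | pt_b | pt_c | pt_e

definition d4 :: "four_points \<Rightarrow> four_points \<Rightarrow> real" where
  "d4 x y = (if x = y then 0 else if {x, y} = {pt_a, pt_c} then 1
             else if {x, y} = {pt_b, pt_e} then 2 else 3)"

definition \<rho>4 :: "four_points \<Rightarrow> four_points \<Rightarrow> real" where
  "\<rho>4 x y = (if x = y then 0 else if {x, y} = {pt_a, pt_c} then 2
             else if {x, y} = {pt_b, pt_e} then 2 else 3)"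

lemma UNIV_four_points: "(UNIV :: four_points set) = {pt_a, pt_b, pt_c, pt_e}"
  by (auto intro: four_points.exhaust)

lemma ultrametric_space_d4: "ultrametric_space UNIV d4"
  unfolding ultrametric_space_def semimetric_space_def UNIV_four_points
  by (simp add: d4_def doubleton_eq_iff)

lemma ultrametric_space_\<rho>4: "ultrametric_space UNIV \<rho>4"
  unfolding ultrametric_space_def semimetric_space_def UNIV_four_points
  by (simp add: \<rho>4_def doubleton_eq_iff)

end

theory Submission
  imports Defs
begin

text \<open>
  A labeled star with center \<open>c\<close> generates \<open>d\<close> exactly when \<open>d u v = max (m u) (m v)\<close> for all
  \<open>u \<noteq> v\<close>, where \<open>m\<close> has its minimum at \<open>c\<close>; one may then take \<open>m = d c\<close>. Both forbidden
  subspaces say that two disjoint pairs \<open>p, q\<close> and \<open>r, s\<close> are each closer together than the pairs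
  are to each other, which contradicts this formula. Conversely, choose \<open>c\<close> to be a limit point,
  or an endpoint of a shortest distance: there are points other than \<open>c\<close> at least as close to \<open>c\<close>
  as any two given distinct points are to each other. If the formula with \<open>m = d c\<close> failed at
  \<open>u, v\<close>, then \<open>u, v\<close> together with \<open>c\<close> and such a point would form a forbidden configuration.
\<close>

section \<open>Star graphs\<close>

definition star_arcs :: "'a set \<Rightarrow> 'a \<Rightarrow> 'a rel" where
  "star_arcs V c = {c} \<times> (V - {c}) \<union> (V - {c}) \<times> {c}"

text \<open>Only the arc set is prescribed; that such a digraph is a tree is derived below. The
  locale thus serves both to analyse a given star graph and to construct one.\<close>

locale star =
  fixes T :: "'a pair_pre_digraph" and c :: 'a
  assumes center: "c \<in> pverts T"
    and arcs_eq: "parcs T = star_arcs (pverts T) c"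
begin

sublocale pair_bidirected_digraph T
proof unfold_locales
  show "Digraph.symmetric (with_proj T)"
    by (auto simp: symmetric_def sym_def arcs_eq star_arcs_def)
qed (use center in \<open>auto simp: arcs_eq star_arcs_def\<close>)

text \<open>After an arc from \<open>c\<close> to a leaf the only way onward is back to
  \<open>c\<close>, which a path must not revisit.\<close>

lemma apath_from_center:
  "apath c p v \<longleftrightarrow> (p = [] \<and> v = c) \<or> (p = [(c, v)] \<and> v \<in> pverts T - {c})"
proof
  assume path: "apath c p v"
  show "(p = [] \<and> v = c) \<or> (p = [(c, v)] \<and> v \<in> pverts T - {c})"
  proof (cases p)
    case Nil
    with path show ?thesis by (auto simp: apath_Nil_iff)
  next
    case (Cons e p')
    then obtain w where w: "e = (c, w)" "w \<in> pverts T - {c}" "apath w p' v"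
      "c \<notin> set (pawalk_verts w p')"
      using path by (cases e) (auto simp: apath_Cons_iff arcs_eq star_arcs_def)
    have "p' = []"
    proof (cases p')
      case (Cons e' p'')
      with w have "apath c p'' v"
        by (cases e') (auto simp: apath_Cons_iff arcs_eq star_arcs_def)
      then have "c \<in> set (pawalk_verts (snd e') p'')"
        using hd_in_awalk_verts(2) w Cons
        by (cases e') (auto simp: apath_Cons_iff arcs_eq star_arcs_def)
      with w(4) Cons show ?thesis by simp
    qed
    with w Cons show ?thesis by (auto simp: apath_Nil_iff)
  qed
qed (use center in \<open>auto simp: apath_Nil_iff apath_Cons_iff arcs_eq star_arcs_def\<close>)

lemma apath_from_leaf:
  assumes "u \<in> pverts T - {c}" "u \<noteq> v"
  shows "apath u p v \<longleftrightarrow>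
    (p = [(u, c)] \<and> v = c) \<or> (p = [(u, c), (c, v)] \<and> v \<in> pverts T - {c})"
proof (cases p)
  case Nil
  with assms show ?thesis by (auto simp: apath_Nil_iff)
next
  case (Cons e p')
  with assms center show ?thesis
    by (cases e)
      (auto simp: apath_Nil_iff apath_Cons_iff apath_from_center arcs_eq star_arcs_def)
qed

text \<open>The path between two leaves runs through \<open>c\<close>; if an endpoint is
  \<open>c\<close> itself, the label \<open>l c\<close> occurs anyway. One formula therefore covers
  all cases.\<close>

lemma label_dist_eq:
  assumes "u \<in> pverts T" "v \<in> pverts T" "u \<noteq> v"
  shows "label_dist T l u v = max (l c) (max (l u) (l v))"
proof -
  have "(THE p. apath u p v) =
      (if u = c then [(c, v)] else if v = c then [(u, c)] else [(u, c), (c, v)])"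
    using assms by (intro the_equality) (auto simp: apath_from_center apath_from_leaf)
  then show ?thesis
    using assms by (auto simp: label_dist_def tree_path_def max_def awalk_verts_with_proj_eq)
qed

lemma no_long_cycle:
  assumes "cycle p" "3 \<le> length p"
  shows False
proof -
  obtain u where walk: "awalk u p u" and dist: "distinct (tl (pawalk_verts u p))"
    using assms(1) by (auto simp: cycle_def)
  obtain e1 e2 e3 es where p: "p = e1 # e2 # e3 # es"
    using assms(2) by (auto simp: numeral_3_eq_3 Suc_le_length_iff)
  have rest: "awalk (snd e3) es u"
    using walk unfolding p by (auto simp: awalk_Cons_iff)
  have last: "u \<in> set (pawalk_verts (snd e3) es)"
    using awalkE[OF rest] last_in_set[OF awalk_verts_non_Nil] by metis
  have head: "snd e3 \<in> set (pawalk_verts (snd e3) es)"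
    using hd_in_awalk_verts(1)[OF rest] .
  \<comment> \<open>Every arc joins \<open>c\<close> to a leaf, so a walk is at \<open>c\<close> at
    every second vertex. Either way \<open>c\<close> is met twice after the start: in the first case
    at the end of \<open>e2\<close> and again at the end of the closed walk.\<close>
  have "snd e2 = c \<and> u = c \<or> snd e1 = c \<and> snd e3 = c"
    using walk unfolding p awalk_Cons_iff arcs_eq star_arcs_def by auto
  with dist last head show False
    using walk unfolding p by (auto simp: awalk_Cons_iff)
qed

lemma is_connected: "Digraph_Component.connected (with_proj T)"
proof -
  have dom: "u \<rightarrow>\<^sup>*\<^bsub>with_proj T\<^esub> c" if "u \<in> pverts T" for u
  proof (cases "u = c")
    case False
    with that have "(u, c) \<in> parcs T" by (auto simp: arcs_eq star_arcs_def)
    then show ?thesis by (intro reachable_adjI) simp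
  qed (use center in auto)
  then have "u \<rightarrow>\<^sup>*\<^bsub>with_proj T\<^esub> v" if "u \<in> pverts T" "v \<in> pverts T" for u v
    using that by (meson reachable_trans symmetric_reachable')
  then show ?thesis
    using center
    by (auto simp: connected_def strongly_connected_def reachable_mk_symmetric_eq[OF sym_arcs])
qed

lemma is_star_graph: "star_graph T c"
  unfolding star_graph_def graph_tree_def
  using is_connected no_long_cycle center pair_bidirected_digraph_axioms
  by (auto simp: arcs_eq star_arcs_def)

end

lemma star_graph_imp_star:
  assumes "star_graph T c"
  shows "star T c"
proof
  interpret pair_bidirected_digraph T
    using assms by (simp add: star_graph_def graph_tree_def)
  show "c \<in> pverts T" using assms by (simp add: star_graph_def)
  have "(v, c) \<in> parcs T" if "(c, v) \<in> parcs T" for v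
    using arcs_ends_symmetric[OF sym_arcs] that by simp
  then have "star_arcs (pverts T) c \<subseteq> parcs T"
    using assms unfolding star_graph_def star_arcs_def by blast
  moreover have "(x, y) \<in> star_arcs (pverts T) c" if "(x, y) \<in> parcs T" for x y
    using assms that in_arcsD1[OF that] in_arcsD2[OF that] no_loops'[OF that]
    unfolding star_graph_def star_arcs_def by blast
  ultimately show "parcs T = star_arcs (pverts T) c"
    by (auto intro: subset_antisym)
qed

text \<open>This removes trees from the problem. A label \<open>l\<close> at the leaves and the
  center enters only through \<open>d c u = max (l c) (l u)\<close>, so it can be replaced by
  \<open>d c\<close>.\<close>

lemma US_space_iff:
  assumes ultra: "ultrametric_space X d"
  shows "US_space X d \<longleftrightarrow>
    (\<exists>c\<in>X. \<forall>u\<in>X. \<forall>v\<in>X. u \<noteq> v \<longrightarrow> d u v = max (d c u) (d c v))"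
    (is "_ \<longleftrightarrow> ?R")
proof
  have d0: "d x x = 0" and nonneg: "0 \<le> d x y" if "x \<in> X" "y \<in> X" for x y
    using ultra that by (auto simp: ultrametric_space_def semimetric_space_def)
  {
    assume "US_space X d"
    then obtain T l c where star: "star_graph T c" and gen: "generated_by X d T l"
      by (auto simp: US_space_def)
    interpret star T c using star by (rule star_graph_imp_star)
    have X: "X = pverts T" using gen by (simp add: generated_by_def)
    have dist: "d u v = max (l c) (max (l u) (l v))" if "u \<in> X" "v \<in> X" "u \<noteq> v" for u v
      using gen that label_dist_eq[of u v l] by (auto simp: generated_by_def)
    have "d u v = max (d c u) (d c v)" if uv: "u \<in> X" "v \<in> X" "u \<noteq> v" for u v
    proof -
      consider "u = c" | "v = c" | "u \<noteq> c" "v \<noteq> c" by blast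
      then show ?thesis
      proof cases
        case 1
        then show ?thesis using d0[of c c] nonneg[of c v] uv by simp
      next
        case 2
        then have "d u v = d v u" using dist[of u v] dist[of v u] uv by (simp add: max.commute)
        with 2 show ?thesis using d0[of c c] nonneg[of c u] uv by simp
      next
        case 3
        then show ?thesis
          using dist[of u v] dist[of c u] dist[of c v] uv center X
          by (simp add: max.assoc max.left_commute)
      qed
    qed
    then show ?R using center X by blast
  }
  {
    assume ?R
    then obtain c where c: "c \<in> X"
      and dist: "\<And>u v. u \<in> X \<Longrightarrow> v \<in> X \<Longrightarrow> u \<noteq> v \<Longrightarrow> d u v = max (d c u) (d c v)"
      by blast
    define T where "T = \<lparr>pverts = X, parcs = star_arcs X c\<rparr>"
    interpret star T c by standard (simp_all add: T_def c)
    \<comment> \<open>With these labels the center gets \<open>d c c = 0\<close>, which does not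
      affect the maximum along a path.\<close>
    have "generated_by X d T (d c)"
      unfolding generated_by_def labeled_tree_def
    proof (intro conjI ballI)
      show "graph_tree T" using is_star_graph by (simp add: star_graph_def)
      show "X = pverts T" by (simp add: T_def)
      show "0 \<le> d c v" if "v \<in> pverts T" for v using nonneg c that by (simp add: T_def)
      show "d x y = label_dist T (d c) x y" if "x \<in> X" "y \<in> X" for x y
      proof (cases "x = y")
        case True
        then show ?thesis using that d0 by (simp add: label_dist_def)
      next
        case False
        then show ?thesis
          using label_dist_eq[of x y "d c"] dist that d0[of c] nonneg c
          by (simp add: T_def max_def)
      qed
    qed
    then show "US_space X d" using is_star_graph ultra by (auto simp: US_space_def)
  }
qed

section \<open>Forbidden subspaces\<close>

text \<open>Strict monotonicity makes \<open>f\<close> injective, and the distance equation together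
  with the bijectivity of \<open>\<Phi>\<close> makes it onto.\<close>

lemma weakly_similarI:
  assumes bij: "bij_betw \<Phi> X Y"
    and mono: "strict_mono_on (dist_set Y \<rho>) f"
    and eq: "\<And>x y. x \<in> X \<Longrightarrow> y \<in> X \<Longrightarrow> d x y = f (\<rho> (\<Phi> x) (\<Phi> y))"
  shows "weakly_similar X d Y \<rho>"
proof -
  have "f ` dist_set Y \<rho> = dist_set X d"
    using bij_betw_imp_surj_on[OF bij] eq unfolding dist_set_def by (auto simp: image_iff) metis+
  then show ?thesis
    using assms strict_mono_on_imp_inj_on[OF mono]
    unfolding weakly_similar_def bij_betw_def by blast
qed

text \<open>The common feature of the two forbidden spaces. Comparing with the single cross distance
  \<open>d p r\<close> is enough, since in an ultrametric space all four cross distances then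
  coincide.\<close>

definition separated_pairs :: "'a set \<Rightarrow> ('a \<Rightarrow> 'a \<Rightarrow> real) \<Rightarrow> bool" where
  "separated_pairs X d \<longleftrightarrow>
     (\<exists>p\<in>X. \<exists>q\<in>X. \<exists>r\<in>X. \<exists>s\<in>X. p \<noteq> q \<and> r \<noteq> s \<and> d p q < d p r \<and> d r s < d p r)"

lemma separated_pairs_mono:
  "separated_pairs Y d \<Longrightarrow> Y \<subseteq> X \<Longrightarrow> separated_pairs X d"
  unfolding separated_pairs_def by blast

text \<open>The condition only compares distances and points, so the inverse of
  \<open>\<Phi>\<close> and the increasing \<open>f\<close> carry it over.\<close>

lemma weakly_similar_separated_pairs:
  assumes sim: "weakly_similar X d Y \<rho>" and sep: "separated_pairs Y \<rho>"
  shows "separated_pairs X d"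
proof -
  obtain \<Phi> f where \<Phi>: "bij_betw \<Phi> X Y" and mono: "strict_mono_on (dist_set Y \<rho>) f"
    and eq: "\<And>x y. x \<in> X \<Longrightarrow> y \<in> X \<Longrightarrow> d x y = f (\<rho> (\<Phi> x) (\<Phi> y))"
    using sim unfolding weakly_similar_def by blast
  define \<Psi> where "\<Psi> = inv_into X \<Phi>"
  have \<Psi>: "\<Psi> y \<in> X" "\<Phi> (\<Psi> y) = y" if "y \<in> Y" for y
    using \<Phi> that unfolding \<Psi>_def
    by (simp_all add: bij_betw_inv_into_right bij_betw_imp_surj_on inv_into_into)
  have d\<Psi>: "d (\<Psi> x) (\<Psi> y) = f (\<rho> x y)" if "x \<in> Y" "y \<in> Y" for x y
    using that by (simp add: eq \<Psi>)
  have less: "f (\<rho> x y) < f (\<rho> x' y')"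
    if "x \<in> Y" "y \<in> Y" "x' \<in> Y" "y' \<in> Y" "\<rho> x y < \<rho> x' y'" for x y x' y'
    by (rule strict_mono_onD[OF mono]) (use that in \<open>auto simp: dist_set_def\<close>)
  obtain p q r s where pts: "p \<in> Y" "q \<in> Y" "r \<in> Y" "s \<in> Y" and ne: "p \<noteq> q" "r \<noteq> s"
    and lt: "\<rho> p q < \<rho> p r" "\<rho> r s < \<rho> p r"
    using sep unfolding separated_pairs_def by blast
  show ?thesis
    unfolding separated_pairs_def
  proof (intro bexI conjI)
    show "\<Psi> p \<noteq> \<Psi> q" "\<Psi> r \<noteq> \<Psi> s" using \<Psi>(2) pts ne by metis+
    show "d (\<Psi> p) (\<Psi> q) < d (\<Psi> p) (\<Psi> r)" "d (\<Psi> r) (\<Psi> s) < d (\<Psi> p) (\<Psi> r)"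
      using less lt pts by (simp_all add: d\<Psi>)
  qed (use \<Psi>(1) pts in auto)
qed

lemma separated_pairs_d4: "separated_pairs UNIV d4"
  unfolding separated_pairs_def
  by (rule bexI[of _ pt_a], rule bexI[of _ pt_c], rule bexI[of _ pt_b], rule bexI[of _ pt_e])
    (auto simp: d4_def doubleton_eq_iff)

lemma separated_pairs_\<rho>4: "separated_pairs UNIV \<rho>4"
  unfolding separated_pairs_def
  by (rule bexI[of _ pt_a], rule bexI[of _ pt_c], rule bexI[of _ pt_b], rule bexI[of _ pt_e])
    (auto simp: \<rho>4_def doubleton_eq_iff)

text \<open>In an ultrametric triangle the two longest sides are equal, so every cross distance is
  \<open>d p r\<close>. What remains is whether the two short distances differ, giving
  \<open>d4\<close>, or agree, giving \<open>\<rho>4\<close>.\<close>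

lemma four_point_subspace:
  assumes ultra: "ultrametric_space X d"
    and pts: "p \<in> X" "q \<in> X" "r \<in> X" "s \<in> X" "p \<noteq> q" "r \<noteq> s"
    and sep: "d r s < d p r" and le: "d p q \<le> d r s"
  shows "\<exists>Y\<subseteq>X. card Y = 4 \<and>
    (weakly_similar Y d (UNIV :: four_points set) d4 \<or>
     weakly_similar Y d (UNIV :: four_points set) \<rho>4)"
proof -
  have nonneg: "0 \<le> d x y" and sym: "d x y = d y x" and zero: "d x y = 0 \<longleftrightarrow> x = y"
    if "x \<in> X" "y \<in> X" for x y
    using ultra that by (auto simp: ultrametric_space_def semimetric_space_def)
  have tri: "d x y \<le> max (d x z) (d z y)" if "x \<in> X" "y \<in> X" "z \<in> X" for x y z
    using ultra that by (auto simp: ultrametric_space_def)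
  let ?R = "d p r" and ?Y = "{p, q, r, s}"
  have pos: "0 < d p q" "0 < d r s"
    using nonneg zero pts by (metis less_eq_real_def)+
  have qr: "d q r = ?R"
    using tri[of p r q] tri[of q r p] sym[of p q] pts sep le by auto
  have ps: "d p s = ?R"
    using tri[of p r s] tri[of p s r] sym[of r s] pts sep le by auto
  have qs: "d q s = ?R"
    using tri[of q r s] tri[of q s r] sym[of r s] qr pts sep le by auto
  have ne: "p \<noteq> r" "p \<noteq> s" "q \<noteq> r" "q \<noteq> s"
    using zero[of p r] zero[of p s] zero[of q r] zero[of q s] qr ps qs pts sep pos by simp_all
  note swaps = sym[of q p] sym[of s r] sym[of r p] sym[of r q] sym[of s p] sym[of s q]
  note zeros = zero[of p p] zero[of q q] zero[of r r] zero[of s s]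
  \<comment> \<open>The pair that is at least as close goes to \<open>pt_a, pt_c\<close>, whose
    distance in \<open>d4\<close> is the smaller one.\<close>
  define \<Phi> where "\<Phi> x = (if x = p then pt_a else if x = q then pt_c
    else if x = r then pt_b else pt_e)" for x
  have \<Phi>: "bij_betw \<Phi> ?Y UNIV"
    using pts ne by (auto simp: bij_betw_def inj_on_def \<Phi>_def UNIV_four_points)
  have "weakly_similar ?Y d (UNIV :: four_points set) d4" if "d p q < d r s"
  proof (rule weakly_similarI[OF \<Phi>])
    \<comment> \<open>The final branch is meant for \<open>t = 3\<close>; values of
      \<open>?f\<close> outside the distance set do not matter.\<close>
    let ?f = "\<lambda>t::real. if t = 0 then 0 else if t = 1 then d p q else if t = 2 then d r s else ?R"
    have "dist_set UNIV d4 \<subseteq> {0, 1, 2, 3}"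
      by (auto simp: dist_set_def d4_def)
    moreover have "strict_mono_on {0, 1, 2, 3} ?f"
      using that sep pos by (auto simp: strict_mono_on_def)
    ultimately show "strict_mono_on (dist_set UNIV d4) ?f"
      by (rule monotone_on_subset[rotated])
    show "d x y = ?f (d4 (\<Phi> x) (\<Phi> y))" if "x \<in> ?Y" "y \<in> ?Y" for x y
      using that pts ne swaps zeros qr ps qs by (auto simp: \<Phi>_def d4_def doubleton_eq_iff)
  qed
  moreover have "weakly_similar ?Y d (UNIV :: four_points set) \<rho>4" if "d p q = d r s"
  proof (rule weakly_similarI[OF \<Phi>])
    let ?f = "\<lambda>t::real. if t = 0 then 0 else if t = 2 then d r s else ?R"
    have "dist_set UNIV \<rho>4 \<subseteq> {0, 2, 3}"
      by (auto simp: dist_set_def \<rho>4_def)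
    moreover have "strict_mono_on {0, 2, 3} ?f"
      using sep pos by (auto simp: strict_mono_on_def)
    ultimately show "strict_mono_on (dist_set UNIV \<rho>4) ?f"
      by (rule monotone_on_subset[rotated])
    show "d x y = ?f (\<rho>4 (\<Phi> x) (\<Phi> y))" if "x \<in> ?Y" "y \<in> ?Y" for x y
      using that pts ne swaps zeros qr ps qs \<open>d p q = d r s\<close>
      by (auto simp: \<Phi>_def \<rho>4_def doubleton_eq_iff)
  qed
  moreover have "card ?Y = 4" using pts ne by simp
  moreover have "d p q < d r s \<or> d p q = d r s" using le by auto
  ultimately show ?thesis
    using pts by (intro exI[of _ ?Y]) auto
qed

lemma forbidden_subspace_iff:
  assumes ultra: "ultrametric_space X d"
  shows "(\<exists>Y\<subseteq>X. card Y = 4 \<and>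
      (weakly_similar Y d (UNIV :: four_points set) d4 \<or>
       weakly_similar Y d (UNIV :: four_points set) \<rho>4)) \<longleftrightarrow> separated_pairs X d"
    (is "?F \<longleftrightarrow> _")
proof
  assume ?F
  then show "separated_pairs X d"
    using weakly_similar_separated_pairs separated_pairs_d4 separated_pairs_\<rho>4
      separated_pairs_mono by blast
next
  assume "separated_pairs X d"
  then obtain p q r s where pts: "p \<in> X" "q \<in> X" "r \<in> X" "s \<in> X" "p \<noteq> q" "r \<noteq> s"
    and sep: "d p q < d p r" "d r s < d p r"
    unfolding separated_pairs_def by blast
  have sym: "d p r = d r p"
    using ultra pts by (simp add: ultrametric_space_def semimetric_space_def)
  show ?F
  proof (cases "d p q \<le> d r s")
    case True
    show ?thesis by (rule four_point_subspace[OF ultra pts sep(2) True])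
  next
    case False
    show ?thesis
      \<comment> \<open>The two pairs exchange roles, so that the closer one comes first.\<close>
      by (rule four_point_subspace[OF ultra pts(3,4,1,2,6,5)]) (use sep sym False in simp_all)
  qed
qed

section \<open>Choice of the center\<close>

text \<open>Points of the sequence eventually come closer to \<open>a\<close> than the positive
  number \<open>d u v\<close>.\<close>

lemma ex_center_limit_point:
  assumes ultra: "ultrametric_space X d" and lim: "limit_point_of X d a"
  shows "\<exists>c\<in>X. \<forall>u\<in>X. \<forall>v\<in>X. u \<noteq> v \<longrightarrow> (\<exists>q\<in>X - {c}. d c q \<le> d u v)"
proof (rule bexI[of _ a], intro ballI impI)
  obtain t :: "nat \<Rightarrow> 'a" where t: "inj t" "range t \<subseteq> X" "(\<lambda>n. d (t n) a) \<longlonglongrightarrow> 0" and a: "a \<in> X"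
    using lim by (auto simp: limit_point_of_def)
  fix u v assume uv: "u \<in> X" "v \<in> X" "u \<noteq> v"
  have "0 < d u v"
    using ultra uv unfolding ultrametric_space_def semimetric_space_def
    by (metis less_eq_real_def)
  with t(3) have "\<forall>\<^sub>F n in sequentially. d (t n) a < d u v"
    by (rule order_tendstoD)
  then obtain N where N: "\<And>n. n \<ge> N \<Longrightarrow> d (t n) a < d u v"
    by (auto simp: eventually_sequentially)
  \<comment> \<open>By injectivity, at most one of \<open>t N\<close> and \<open>t (Suc N)\<close>
    equals \<open>a\<close>.\<close>
  obtain n where "n \<ge> N" "t n \<noteq> a"
    using t(1) by (metis injD le_refl n_not_Suc_n le_SucI)
  moreover have tn: "t n \<in> X" using t(2) by auto
  moreover have "d a (t n) = d (t n) a"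
    using ultra a tn unfolding ultrametric_space_def semimetric_space_def by blast
  ultimately show "\<exists>q\<in>X - {a}. d a q \<le> d u v"
    using N[of n] by (intro bexI[of _ "t n"]) auto
qed (use lim in \<open>simp add: limit_point_of_def\<close>)

text \<open>A pair of distinct points at least distance supplies \<open>c\<close> and
  \<open>q\<close>, the same for all \<open>u, v\<close>. For a single point the claim is
  vacuous.\<close>

lemma ex_center_finite:
  fixes d :: "'a \<Rightarrow> 'a \<Rightarrow> real"
  assumes "finite X" "X \<noteq> {}"
  shows "\<exists>c\<in>X. \<forall>u\<in>X. \<forall>v\<in>X. u \<noteq> v \<longrightarrow> (\<exists>q\<in>X - {c}. d c q \<le> d u v)"
proof (cases "\<exists>u\<in>X. \<exists>v\<in>X. u \<noteq> v")
  case True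
  let ?P = "{z \<in> X \<times> X. fst z \<noteq> snd z}"
  have P: "finite ?P" "?P \<noteq> {}" using assms True by auto
  define z where "z = arg_min_on (case_prod d) ?P"
  have z: "z \<in> ?P"
    unfolding z_def by (rule arg_min_if_finite(1)[OF P])
  have min: "case_prod d z \<le> case_prod d w" if "w \<in> ?P" for w
    unfolding z_def by (rule arg_min_least[OF P that])
  show ?thesis
  proof (rule bexI[of _ "fst z"], intro ballI impI)
    show "\<exists>q\<in>X - {fst z}. d (fst z) q \<le> d u v" if "u \<in> X" "v \<in> X" "u \<noteq> v" for u v
      using z min[of "(u, v)"] that by (intro bexI[of _ "snd z"]) (auto simp: case_prod_beta)
  qed (use z in auto)
qed (use assms in auto)

theorem theorem4p3:
  fixes X :: "'a set" and d :: "'a \<Rightarrow> 'a \<Rightarrow> real"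
  assumes "ultrametric_space X d"
    and "finite X \<or> (\<exists>a. limit_point_of X d a)"
  shows "US_space X d \<longleftrightarrow>
    \<not> (\<exists>Y\<subseteq>X. card Y = 4 \<and>
        (weakly_similar Y d (UNIV :: four_points set) d4 \<or>
         weakly_similar Y d (UNIV :: four_points set) \<rho>4))"
proof -
  have nonempty: "X \<noteq> {}" and d0: "\<And>x. x \<in> X \<Longrightarrow> d x x = 0"
    and sym: "\<And>x y. x \<in> X \<Longrightarrow> y \<in> X \<Longrightarrow> d x y = d y x"
    and nonneg: "\<And>x y. x \<in> X \<Longrightarrow> y \<in> X \<Longrightarrow> 0 \<le> d x y"
    and tri: "\<And>x y z. x \<in> X \<Longrightarrow> y \<in> X \<Longrightarrow> z \<in> X \<Longrightarrow> d x y \<le> max (d x z) (d z y)"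
    using assms(1) unfolding ultrametric_space_def semimetric_space_def by blast+
  have "(\<exists>c\<in>X. \<forall>u\<in>X. \<forall>v\<in>X. u \<noteq> v \<longrightarrow> d u v = max (d c u) (d c v)) \<longleftrightarrow> \<not> separated_pairs X d"
    (is "?C \<longleftrightarrow> _")
  proof
    assume ?C
    then obtain c where c: "c \<in> X"
      "\<And>u v. u \<in> X \<Longrightarrow> v \<in> X \<Longrightarrow> u \<noteq> v \<Longrightarrow> d u v = max (d c u) (d c v)"
      by blast
    show "\<not> separated_pairs X d"
    proof
      assume "separated_pairs X d"
      then obtain p q r s where pts: "p \<in> X" "q \<in> X" "r \<in> X" "s \<in> X" "p \<noteq> q" "r \<noteq> s"
        and sep: "d p q < d p r" "d r s < d p r"
        unfolding separated_pairs_def by blast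
      have "p \<noteq> r" using sep(1) nonneg[of p q] d0 pts by auto
      \<comment> \<open>The formula gives \<open>d c p \<le> d p q\<close> and
        \<open>d c r \<le> d r s\<close>, so \<open>d p r\<close> is at most the larger of
        \<open>d p q\<close> and \<open>d r s\<close>.\<close>
      then show False
        using c(2)[of p q] c(2)[of r s] c(2)[of p r] pts sep by auto
    qed
  next
    assume nosep: "\<not> separated_pairs X d"
    have "\<exists>c\<in>X. \<forall>u\<in>X. \<forall>v\<in>X. u \<noteq> v \<longrightarrow> (\<exists>q\<in>X - {c}. d c q \<le> d u v)"
      using assms(2)
    proof (elim disjE exE)
      show ?thesis if "finite X" using ex_center_finite[OF that nonempty] .
      show ?thesis if "limit_point_of X d a" for a using ex_center_limit_point[OF assms(1) that] .
    qed
    then obtain c where c: "c \<in> X"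
      and near: "\<And>u v. u \<in> X \<Longrightarrow> v \<in> X \<Longrightarrow> u \<noteq> v \<Longrightarrow> \<exists>q\<in>X - {c}. d c q \<le> d u v"
      by blast
    have "d u v = max (d c u) (d c v)" if uv: "u \<in> X" "v \<in> X" "u \<noteq> v" for u v
    proof (rule ccontr)
      assume ne: "d u v \<noteq> max (d c u) (d c v)"
      \<comment> \<open>If the formula fails, \<open>d u v\<close> lies strictly below the maximum,
        so the two longest and hence equal sides of the triangle are those at
        \<open>c\<close>.\<close>
      have lt: "d u v < d c u"
        using ne tri[of u v c] tri[of c u v] tri[of c v u] sym[of u c] sym[of v u] uv c by auto
      obtain q where "q \<in> X - {c}" "d c q \<le> d u v" using near uv by blast
      \<comment> \<open>The pairs \<open>c, q\<close> and \<open>u, v\<close> are separated, because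
        \<open>d c q \<le> d u v < d c u\<close>.\<close>
      then show False
        using nosep lt uv c unfolding separated_pairs_def by fastforce
    qed
    then show ?C using c by blast
  qed
  then show ?thesis
    by (simp only: US_space_iff[OF assms(1)] forbidden_subspace_iff[OF assms(1)])
qed

end
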